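(* Let $F$ be a clause set. If the reasoning algorithm with inference rules $\mathrm{A1}^+$, $\mathrm{A2}^+$, and A3, started from $\mathcal{S}_0=\{F\}$, yields a complete and clash-free family of clause sets $\mathcal{S}_n$, then $F$ is satisfiable.
   Context: $\mathcal{ALC}$ interpretations $\mathcal{I}=(\Delta^\mathcal{I},\cdot^\mathcal{I})$ with the standard semantics of $\lnot,\sqcap,\sqcup,\forall R.,\exists R.$. Conjunctive normal forms are defined by mutual induction: a concept literal is $A$, $\lnot A$ ($A$ a concept name), $\exists R.F$ or $\forall R.F$ ($R$ a role name, $F$ a conjunctive normal form); a clause is a finite disjunction of concept literals, represented as a set of literals; a conjunctive normal form is a finite conjunction of clauses, represented as a clause set. A clause set denotes the conjunction of its clauses, each clause the disjunction of its literals; $F$ is satisfiable if $F^\mathcal{I}\neq\emptyset$ for some $\mathcal{I}$. The complementary literal $\overline{L}$ is: $\overline{A}=\lnot A$, $\overline{\lnot A}=A$, $\overline{\exists R.F}=\forall R.\mathrm{CNF}(\lnot F)$, $\overline{\forall R.F}=\exists R.\mathrm{CNF}(\lnot F)$, with $\mathrm{CNF}(C)$ the equivalent conjunctive normal form of $C$ (push negations inward, distribute $\sqcup$ over $\sqcap$, flatten). A derivation works on families of clause sets $\mathcal{S}_i$, starting with $\mathcal{S}_0=\{F\}$; $\mathcal{S}_{i+1}$ is obtained from $\mathcal{S}_i$ by applying one of the following rules to a clause set $F\in\mathcal{S}_i$: ($\mathrm{A1}^+$) if $L\in CL$ for a clause $CL\in F$ (nondeterministic choice of $L$): replace every clause $CL'\in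 F$ with $L\in CL'$ by $\{L\}$, and every clause $CL'\in F$ with $\overline{L}\in CL'$ by $CL'\setminus\{\overline{L}\}$. ($\mathrm{A2}^+$) if all clauses of $F$ are unit clauses and $\forall R.F_1\in CL$ for some $CL\in F$: remove from $F$ all clauses containing $\forall R.F_1$, and replace every literal $\exists R.F_2$ occurring in clauses of $F$ by $\exists R.(F_1\cup F_2)$. (A3) if all clauses of $F$ are unit clauses of the form $\{A\}$, $\{\lnot A\}$ or $\{\exists R.F'\}$: for some $\{\exists R.F_1\}\in F$, replace $F$ by $F\setminus\{\{\exists R.F_1\}\}$ and add $F_1$ to the family ($F$ is the parent of $F_1$ with respect to $R$). A family is complete if no rule is applicable to it. It is clash-free if no clause set in it contains the empty clause or contains both $\{L\}$ and $\{\overline{L}\}$ for some literal $L$. *)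

theory Defs
  imports "HOL-Library.FSet" "HOL-Library.FuncSet"
begin

section \<open>Concept literals, clauses and conjunctive normal forms\<close>

datatype ('c, 'r) lit =
    Pos 'c
  | Neg 'c
  | Ex 'r "('c, 'r) lit fset fset"
  | All 'r "('c, 'r) lit fset fset"

type_synonym ('c, 'r) clause = "('c, 'r) lit fset"

text \<open>A conjunctive normal form is the same thing as a finite clause set.\<close>

type_synonym ('c, 'r) cset = "('c, 'r) clause fset"

lemma size_lit_less:
  fixes F :: "('c, 'r) cset"
  assumes "CL |\<in>| F" "L |\<in>| CL"
  shows "size L < size (Ex R F)" "size L < size (All R F)"
proof -
  have "Suc (size L) \<le> (\<Sum>L \<in> fset CL. Suc (size L))"
    using assms(2) by (intro member_le_sum) auto
  moreover have "Suc (\<Sum>L \<in> fset CL. Suc (size L))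
      \<le> (\<Sum>CL \<in> fset F. Suc (\<Sum>L \<in> fset CL. Suc (size L)))"
    using assms(1) by (intro member_le_sum[where f = "\<lambda>CL. Suc (\<Sum>L \<in> fset CL. Suc (size L))"]) auto
  ultimately show "size L < size (Ex R F)" "size L < size (All R F)"
    by auto
qed


section \<open>Semantics\<close>

record ('d, 'c, 'r) interp =
  Dom :: "'d set"
  con :: "'c \<Rightarrow> 'd set"
  rol :: "'r \<Rightarrow> ('d \<times> 'd) set"

definition is_interp :: "('d, 'c, 'r) interp \<Rightarrow> bool" where
  "is_interp I \<longleftrightarrow> Dom I \<noteq> {} \<and> (\<forall>A. con I A \<subseteq> Dom I) \<and> (\<forall>R. rol I R \<subseteq> Dom I \<times> Dom I)"

function lit_ext :: "('d, 'c, 'r) interp \<Rightarrow> ('c, 'r) lit \<Rightarrow> 'd set" where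
  "lit_ext I (Pos A) = con I A"
| "lit_ext I (Neg A) = Dom I - con I A"
| "lit_ext I (Ex R F) =
     {x \<in> Dom I. \<exists>y \<in> Dom I. (x, y) \<in> rol I R \<and> (\<forall>CL |\<in>| F. \<exists>L |\<in>| CL. y \<in> lit_ext I L)}"
| "lit_ext I (All R F) =
     {x \<in> Dom I. \<forall>y \<in> Dom I. (x, y) \<in> rol I R \<longrightarrow> (\<forall>CL |\<in>| F. \<exists>L |\<in>| CL. y \<in> lit_ext I L)}"
  by pat_completeness auto
termination
  by (relation "measure (\<lambda>(I, L). size L)") (auto simp del: lit.size intro: size_lit_less)

definition cset_ext :: "('d, 'c, 'r) interp \<Rightarrow> ('c, 'r) cset \<Rightarrow> 'd set" where
  "cset_ext I F = {x \<in> Dom I. \<forall>CL |\<in>| F. \<exists>L |\<in>| CL. x \<in> lit_ext I L}"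

lemma lit_ext_quant:
  "lit_ext I (Ex R F) = {x \<in> Dom I. \<exists>y. (x, y) \<in> rol I R \<and> y \<in> cset_ext I F}"
  "lit_ext I (All R F) = {x \<in> Dom I. \<forall>y \<in> Dom I. (x, y) \<in> rol I R \<longrightarrow> y \<in> cset_ext I F}"
  by (auto simp: cset_ext_def)

text \<open>HOL cannot quantify over the type of the domain elements inside a formula, so the domain is
  taken to be a nonempty subset of the natural numbers. The lemma \<open>satisfiable_if_model\<close> below shows
  that this is no restriction: a clause set with a model over any domain is satisfiable
  in this sense.\<close>

definition satisfiable :: "('c, 'r) cset \<Rightarrow> bool" where
  "satisfiable F \<longleftrightarrow> (\<exists>I :: (nat, 'c, 'r) interp. is_interp I \<and> cset_ext I F \<noteq> {})"

definition lit_closed :: "('c, 'r) lit set \<Rightarrow> bool" where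
  "lit_closed \<Sigma> \<longleftrightarrow>
    (\<forall>R G CL L. Ex R G \<in> \<Sigma> \<or> All R G \<in> \<Sigma> \<longrightarrow> CL |\<in>| G \<longrightarrow> L |\<in>| CL \<longrightarrow> L \<in> \<Sigma>)"

lemma lit_closedD:
  "lit_closed \<Sigma> \<Longrightarrow> Ex R G \<in> \<Sigma> \<or> All R G \<in> \<Sigma> \<Longrightarrow> CL |\<in>| G \<Longrightarrow> L |\<in>| CL \<Longrightarrow> L \<in> \<Sigma>"
  unfolding lit_closed_def by blast

lemma lit_closed_finite:
  fixes L :: "('c, 'r) lit"
  shows "\<exists>\<Sigma>. finite \<Sigma> \<and> L \<in> \<Sigma> \<and> lit_closed \<Sigma>"
proof -
  have quant: "\<exists>\<Sigma>. finite \<Sigma> \<and> Ex R F \<in> \<Sigma> \<and> All R F \<in> \<Sigma> \<and> lit_closed \<Sigma>"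
    if IH: "\<And>CL L. CL |\<in>| F \<Longrightarrow> L |\<in>| CL \<Longrightarrow> \<exists>\<Sigma>. finite \<Sigma> \<and> L \<in> \<Sigma> \<and> lit_closed \<Sigma>"
    for R and F :: "('c, 'r) cset"
  proof -
    define \<sigma> where "\<sigma> L = (SOME \<Sigma>. finite \<Sigma> \<and> L \<in> \<Sigma> \<and> lit_closed \<Sigma>)" for L :: "('c, 'r) lit"
    have \<sigma>: "finite (\<sigma> L) \<and> L \<in> \<sigma> L \<and> lit_closed (\<sigma> L)" if "CL |\<in>| F" "L |\<in>| CL" for CL L
      unfolding \<sigma>_def by (rule someI_ex[OF IH[OF that]])
    define T where "T = (\<Union>CL \<in> fset F. \<Union>L \<in> fset CL. \<sigma> L)"
    have fin: "finite T" unfolding T_def using \<sigma> by auto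
    have sub: "L \<in> T" if "CL |\<in>| F" "L |\<in>| CL" for CL L
      unfolding T_def using \<sigma> that by blast
    have T: "L' \<in> T" if QG: "Ex Q G \<in> T \<or> All Q G \<in> T" "CL' |\<in>| G" "L' |\<in>| CL'" for Q G CL' L'
    proof -
      obtain CL L where L: "CL |\<in>| F" "L |\<in>| CL" "Ex Q G \<in> \<sigma> L \<or> All Q G \<in> \<sigma> L"
        using QG(1) unfolding T_def by blast
      then have "L' \<in> \<sigma> L" using \<sigma> lit_closedD QG(2,3) by metis
      then show ?thesis using L unfolding T_def by blast
    qed
    have "lit_closed (insert (Ex R F) (insert (All R F) T))"
      unfolding lit_closed_def
    proof (intro allI impI)
      fix Q G CL' L'
      assume a: "Ex Q G \<in> insert (Ex R F) (insert (All R F) T) \<or> All Q G \<in> insert (Ex R F) (insert (All R F) T)"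
        and "CL' |\<in>| G" "L' |\<in>| CL'"
      moreover have "G = F \<or> Ex Q G \<in> T \<or> All Q G \<in> T" using a by auto
      ultimately have "L' \<in> T" using T sub by metis
      then show "L' \<in> insert (Ex R F) (insert (All R F) T)" by simp
    qed
    then show ?thesis using fin
      by (intro exI[of _ "insert (Ex R F) (insert (All R F) T)"]) simp
  qed
  show ?thesis
  proof (induction L)
    case (Pos A) show ?case by (rule exI[of _ "{Pos A}"]) (simp add: lit_closed_def)
  next
    case (Neg A) show ?case by (rule exI[of _ "{Neg A}"]) (simp add: lit_closed_def)
  next
    case (Ex R F)
    have "\<exists>\<Sigma>. finite \<Sigma> \<and> Ex R F \<in> \<Sigma> \<and> All R F \<in> \<Sigma> \<and> lit_closed \<Sigma>"
      by (rule quant) (rule Ex)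
    then show ?case by metis
  next
    case (All R F)
    have "\<exists>\<Sigma>. finite \<Sigma> \<and> Ex R F \<in> \<Sigma> \<and> All R F \<in> \<Sigma> \<and> lit_closed \<Sigma>"
      by (rule quant) (rule All)
    then show ?case by metis
  qed
qed

lemma satisfiable_if_model:
  fixes I :: "('d, 'c, 'r) interp" and F :: "('c, 'r) cset"
  assumes I: "is_interp I" and "cset_ext I F \<noteq> {}"
  shows "satisfiable F"
proof -
  define R0 :: 'r where "R0 = undefined"
  obtain \<Sigma> where \<Sigma>: "finite \<Sigma>" "Ex R0 F \<in> \<Sigma>" and closed: "lit_closed \<Sigma>"
    using lit_closed_finite[of "Ex R0 F"] by metis
  obtain e :: "('c, 'r) lit set \<Rightarrow> nat" where e: "inj_on e (Pow \<Sigma>)"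
    using finite_imp_inj_to_nat_seg[of "Pow \<Sigma>"] \<Sigma>(1) by blast
  define h where "h d = e {L \<in> \<Sigma>. d \<in> lit_ext I L}" for d
  have h: "d \<in> lit_ext I L \<longleftrightarrow> d' \<in> lit_ext I L" if "h d = h d'" "L \<in> \<Sigma>" for d d' L
  proof -
    have "{L \<in> \<Sigma>. d \<in> lit_ext I L} = {L \<in> \<Sigma>. d' \<in> lit_ext I L}"
      using that(1) unfolding h_def by (intro inj_onD[OF e]) auto
    then show ?thesis using that(2) by blast
  qed
  define J :: "(nat, 'c, 'r) interp" where
    "J = \<lparr>Dom = h ` Dom I, con = (\<lambda>A. h ` con I A), rol = (\<lambda>R. map_prod h h ` rol I R)\<rparr>"
  have J: "is_interp J" using I unfolding is_interp_def J_def by (fastforce simp: image_iff)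
  have Isub: "con I A \<subseteq> Dom I" "rol I R \<subseteq> Dom I \<times> Dom I" for A R
    using I by (auto simp: is_interp_def)
  have truth: "L \<in> \<Sigma> \<Longrightarrow> d \<in> Dom I \<Longrightarrow> h d \<in> lit_ext J L \<longleftrightarrow> d \<in> lit_ext I L" for L d
  proof (induction L arbitrary: d)
    case (Pos A)
    have "d \<in> con I A" if "d' \<in> con I A" "h d = h d'" for d'
      using h[OF that(2) Pos.prems(1)] that(1) by simp
    then show ?case by (auto simp: J_def)
  next
    case (Neg A)
    have "d \<in> con I A" if "d' \<in> con I A" "h d = h d'" for d'
      using h[OF that(2) Neg.prems(1)] that(1) Neg.prems(2) by simp
    then show ?case using Neg.prems(2) by (auto simp: J_def)
  next
    case (Ex R G)
    have G: "h y \<in> cset_ext J G \<longleftrightarrow> y \<in> cset_ext I G" if "y \<in> Dom I" for y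
    proof -
      have "h y \<in> lit_ext J L \<longleftrightarrow> y \<in> lit_ext I L" if "CL |\<in>| G" "L |\<in>| CL" for CL L
        using Ex.IH[OF that lit_closedD[OF closed _ that] \<open>y \<in> Dom I\<close>] Ex.prems by blast
      moreover have "h y \<in> Dom J" using that by (simp add: J_def)
      ultimately show ?thesis using that unfolding cset_ext_def by blast
    qed
    show ?case
    proof
      assume "h d \<in> lit_ext J (Ex R G)"
      then obtain d' y where "h d = h d'" "(d', y) \<in> rol I R" "h y \<in> cset_ext J G"
        unfolding lit_ext_quant by (auto simp: J_def)
      moreover then have "d' \<in> lit_ext I (Ex R G)"
        using G Isub unfolding lit_ext_quant by blast
      ultimately show "d \<in> lit_ext I (Ex R G)" using h[OF _ Ex.prems(1)] by blast
    next
      assume "d \<in> lit_ext I (Ex R G)"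
      then obtain y where y: "(d, y) \<in> rol I R" "y \<in> cset_ext I G"
        unfolding lit_ext_quant by blast
      then have "h y \<in> cset_ext J G" using G Isub by blast
      moreover have "(h d, h y) \<in> rol J R" using y by (force simp: J_def)
      moreover have "h d \<in> Dom J" using Ex.prems by (simp add: J_def)
      ultimately show "h d \<in> lit_ext J (Ex R G)" unfolding lit_ext_quant by blast
    qed
  next
    case (All R G)
    have G: "h y \<in> cset_ext J G \<longleftrightarrow> y \<in> cset_ext I G" if "y \<in> Dom I" for y
    proof -
      have "h y \<in> lit_ext J L \<longleftrightarrow> y \<in> lit_ext I L" if "CL |\<in>| G" "L |\<in>| CL" for CL L
        using All.IH[OF that lit_closedD[OF closed _ that] \<open>y \<in> Dom I\<close>] All.prems by blast
      moreover have "h y \<in> Dom J" using that by (simp add: J_def)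
      ultimately show ?thesis using that unfolding cset_ext_def by blast
    qed
    show ?case
    proof
      assume a: "h d \<in> lit_ext J (All R G)"
      have "y \<in> cset_ext I G" if "(d, y) \<in> rol I R" for y
      proof -
        have "(h d, h y) \<in> rol J R" using that by (force simp: J_def)
        then show ?thesis using a G Isub that J unfolding lit_ext_quant is_interp_def by blast
      qed
      then show "d \<in> lit_ext I (All R G)" using All.prems unfolding lit_ext_quant by blast
    next
      assume a: "d \<in> lit_ext I (All R G)"
      have "z \<in> cset_ext J G" if "(h d, z) \<in> rol J R" for z
      proof -
        obtain d' y where y: "h d = h d'" "z = h y" "(d', y) \<in> rol I R"
          using \<open>(h d, z) \<in> rol J R\<close> by (auto simp: J_def)
        then have "d' \<in> lit_ext I (All R G)" using a h[OF _ All.prems(1)] by blast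
        then show ?thesis using y G Isub unfolding lit_ext_quant by blast
      qed
      moreover have "h d \<in> Dom J" using All.prems by (simp add: J_def)
      ultimately show "h d \<in> lit_ext J (All R G)" unfolding lit_ext_quant by blast
    qed
  qed
  obtain x where x: "x \<in> cset_ext I F" using assms(2) by blast
  have "h x \<in> cset_ext J F"
    using x truth lit_closedD[OF closed disjI1[OF \<Sigma>(2)]] unfolding cset_ext_def by (fastforce simp: J_def)
  then show ?thesis using J unfolding satisfiable_def by blast
qed


section \<open>Complementary literals\<close>

text \<open>Pushing the negation of a clause set \<open>F\<close> inward gives the disjunction over all clauses
  \<open>CL\<close> in \<open>F\<close> of the conjunction over all \<open>L\<close> in \<open>CL\<close> of \<open>g L\<close>, where \<open>g\<close> complements literals.
  Distributing disjunction over conjunction and flattening yields one clause for every way of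
  selecting a literal \<open>f CL\<close> from each clause \<open>CL\<close>, namely the set of all \<open>g (f CL)\<close>.\<close>

definition cnf_neg :: "(('c, 'r) lit \<Rightarrow> ('c, 'r) lit) \<Rightarrow> ('c, 'r) cset \<Rightarrow> ('c, 'r) cset" where
  "cnf_neg g F = Abs_fset ((\<lambda>f. (\<lambda>CL. g (f CL)) |`| F) ` (\<Pi>\<^sub>E CL \<in> fset F. fset CL))"

lemma fset_cnf_neg:
  "fset (cnf_neg g F) = (\<lambda>f. (\<lambda>CL. g (f CL)) |`| F) ` (\<Pi>\<^sub>E CL \<in> fset F. fset CL)"
  unfolding cnf_neg_def by (intro Abs_fset_inverse) (auto intro!: finite_PiE)

lemma cnf_neg_cong [fundef_cong]:
  assumes "F = G" "\<And>CL L. CL |\<in>| G \<Longrightarrow> L |\<in>| CL \<Longrightarrow> g L = h L"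
  shows "cnf_neg g F = cnf_neg h G"
proof -
  have "(\<lambda>CL. g (f CL)) |`| G = (\<lambda>CL. h (f CL)) |`| G" if "f \<in> (\<Pi>\<^sub>E CL \<in> fset G. fset CL)" for f
    using that assms(2) by (intro fimage_cong) (auto simp: PiE_mem)
  then show ?thesis unfolding cnf_neg_def assms(1) by (metis (no_types, lifting) image_cong)
qed

function compl_lit :: "('c, 'r) lit \<Rightarrow> ('c, 'r) lit" where
  "compl_lit (Pos A) = Neg A"
| "compl_lit (Neg A) = Pos A"
| "compl_lit (Ex R F) = All R (cnf_neg compl_lit F)"
| "compl_lit (All R F) = Ex R (cnf_neg compl_lit F)"
  by pat_completeness auto
termination
  by (relation "measure size") (auto simp del: lit.size intro: size_lit_less)

lemma cnf_neg_ext: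
  assumes "\<And>CL L. CL |\<in>| F \<Longrightarrow> L |\<in>| CL \<Longrightarrow> lit_ext I (g L) = Dom I - lit_ext I L"
  shows "cset_ext I (cnf_neg g F) = Dom I - cset_ext I F"
proof (intro set_eqI iffI)
  fix x assume x: "x \<in> cset_ext I (cnf_neg g F)"
  show "x \<in> Dom I - cset_ext I F"
  proof (rule ccontr)
    assume "\<not> ?thesis"
    then have "\<forall>CL |\<in>| F. \<exists>L |\<in>| CL. x \<in> lit_ext I L" using x by (auto simp: cset_ext_def)
    then obtain f where f: "\<And>CL. CL |\<in>| F \<Longrightarrow> f CL |\<in>| CL \<and> x \<in> lit_ext I (f CL)" by metis
    then have "restrict f (fset F) \<in> (\<Pi>\<^sub>E CL \<in> fset F. fset CL)" by auto
    then have "(\<lambda>CL. g (restrict f (fset F) CL)) |`| F |\<in>| cnf_neg g F"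
      unfolding fset_cnf_neg by blast
    then obtain CL where "CL |\<in>| F" "x \<in> lit_ext I (g (restrict f (fset F) CL))"
      using x by (fastforce simp: cset_ext_def)
    then show False using f assms by auto
  qed
next
  fix x assume x: "x \<in> Dom I - cset_ext I F"
  then obtain CL where CL: "CL |\<in>| F" "\<And>L. L |\<in>| CL \<Longrightarrow> x \<notin> lit_ext I L"
    by (auto simp: cset_ext_def)
  have "\<exists>L |\<in>| D. x \<in> lit_ext I L" if "D |\<in>| cnf_neg g F" for D
  proof -
    obtain f where f: "f \<in> (\<Pi>\<^sub>E CL \<in> fset F. fset CL)" "D = (\<lambda>CL. g (f CL)) |`| F"
      using \<open>D |\<in>| cnf_neg g F\<close> unfolding fset_cnf_neg by blast
    then have "f CL |\<in>| CL" "g (f CL) |\<in>| D" using CL(1) by (auto simp: PiE_mem)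
    then show ?thesis using assms[OF CL(1)] CL(2) x by blast
  qed
  then show "x \<in> cset_ext I (cnf_neg g F)" using x by (auto simp: cset_ext_def)
qed

lemma compl_lit_ext:
  assumes "is_interp I"
  shows "lit_ext I (compl_lit L) = Dom I - lit_ext I L"
proof (induction L)
  case (Pos A) show ?case by simp
next
  case (Neg A) then show ?case using assms by (auto simp: is_interp_def)
next
  case (Ex R F)
  then have "cset_ext I (cnf_neg compl_lit F) = Dom I - cset_ext I F" by (intro cnf_neg_ext) blast
  then show ?case using assms unfolding compl_lit.simps lit_ext_quant is_interp_def by blast
next
  case (All R F)
  then have "cset_ext I (cnf_neg compl_lit F) = Dom I - cset_ext I F" by (intro cnf_neg_ext) blast
  then show ?case using assms unfolding compl_lit.simps lit_ext_quant is_interp_def by blast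
qed


section \<open>Inference rules\<close>

definition unit_clause :: "('c, 'r) clause \<Rightarrow> bool" where
  "unit_clause CL \<longleftrightarrow> (\<exists>L. CL = {|L|})"

text \<open>A clause containing both \<open>L\<close> and its complement becomes the unit clause of \<open>L\<close>.\<close>

definition choose_lit :: "('c, 'r) lit \<Rightarrow> ('c, 'r) cset \<Rightarrow> ('c, 'r) cset" where
  "choose_lit L F = (\<lambda>CL. if L |\<in>| CL then {|L|} else CL |-| {|compl_lit L|}) |`| F"

fun add_to_ex :: "'r \<Rightarrow> ('c, 'r) cset \<Rightarrow> ('c, 'r) lit \<Rightarrow> ('c, 'r) lit" where
  "add_to_ex R F\<^sub>1 (Ex Q F\<^sub>2) = (if Q = R then Ex R (F\<^sub>1 |\<union>| F\<^sub>2) else Ex Q F\<^sub>2)"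
| "add_to_ex R F\<^sub>1 L = L"

definition propagate_all :: "'r \<Rightarrow> ('c, 'r) cset \<Rightarrow> ('c, 'r) cset \<Rightarrow> ('c, 'r) cset" where
  "propagate_all R F\<^sub>1 F = (\<lambda>CL. add_to_ex R F\<^sub>1 |`| CL) |`| ffilter (\<lambda>CL. All R F\<^sub>1 |\<notin>| CL) F"

text \<open>A family of clause sets is an indexed family, here a list, together with its parent relation:
  \<open>(i, R, j)\<close> says that the member at index \<open>i\<close> is the parent of the one at index \<open>j\<close> with respect
  to \<open>R\<close>. Applying a rule to a member keeps its index.\<close>

type_synonym ('c, 'r) family = "('c, 'r) cset list \<times> (nat \<times> 'r \<times> nat) set"

text \<open>The rule \<open>A1\<close> only counts as applicable if it changes the clause set; otherwise it would apply
  to every clause set that has a nonempty clause (choose the literal of a unit clause again and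
  again), and no such clause set could occur in a complete family. The other two rules always change
  the clause set they are applied to.\<close>

inductive step :: "('c, 'r) family \<Rightarrow> ('c, 'r) family \<Rightarrow> bool" where
  A1: "i < length S \<Longrightarrow> CL |\<in>| S ! i \<Longrightarrow> L |\<in>| CL \<Longrightarrow> choose_lit L (S ! i) \<noteq> S ! i \<Longrightarrow>
    step (S, P) (S[i := choose_lit L (S ! i)], P)"
| A2: "i < length S \<Longrightarrow> (\<forall>CL |\<in>| S ! i. unit_clause CL) \<Longrightarrow> CL |\<in>| S ! i \<Longrightarrow> All R F\<^sub>1 |\<in>| CL \<Longrightarrow>
    step (S, P) (S[i := propagate_all R F\<^sub>1 (S ! i)], P)"
| A3: "i < length S \<Longrightarrow>
    (\<forall>CL |\<in>| S ! i. (\<exists>A. CL = {|Pos A|}) \<or> (\<exists>A. CL = {|Neg A|}) \<or> (\<exists>Q G. CL = {|Ex Q G|})) \<Longrightarrow>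
    {|Ex R F\<^sub>1|} |\<in>| S ! i \<Longrightarrow>
    step (S, P) (S[i := S ! i |-| {|{|Ex R F\<^sub>1|}|}] @ [F\<^sub>1], insert (i, R, length S) P)"

definition derivable :: "('c, 'r) cset \<Rightarrow> ('c, 'r) family \<Rightarrow> bool" where
  "derivable F \<S> \<longleftrightarrow> step\<^sup>*\<^sup>* ([F], {}) \<S>"

definition complete_family :: "('c, 'r) family \<Rightarrow> bool" where
  "complete_family \<S> \<longleftrightarrow> (\<nexists>\<S>'. step \<S> \<S>')"

definition clash_free :: "('c, 'r) family \<Rightarrow> bool" where
  "clash_free \<S> \<longleftrightarrow>
    (\<forall>F \<in> set (fst \<S>). {||} |\<notin>| F \<and> \<not> (\<exists>L. {|L|} |\<in>| F \<and> {|compl_lit L|} |\<in>| F))"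

end

theory Submission
  imports Defs
begin

text \<open>The indices of the final family \<open>\<S>\<close>, with the final parent relation as roles and the
  remaining positive unit clauses as concept extensions, form a model in which, at every stage of
  the derivation, each index satisfies its current clause set. This is shown backwards along the
  derivation. The delicate rule is \<open>A2\<close>, which drops a universal literal: since \<open>A3\<close> is blocked
  while universal literals are present, every successor is created afterwards, from an existential
  literal into which the dropped clause set has already been merged.\<close>

section \<open>Semantic effect of the rules\<close>

lemma cset_ext_antimono:
  "G |\<subseteq>| H \<Longrightarrow> cset_ext I H \<subseteq> cset_ext I G"
  by (auto simp: cset_ext_def)

text \<open>A1 replaces each clause by one of its subsets, so a true literal of the new clause also
  witnesses the old one. The converse inclusion can fail, since \<open>L\<close> is guessed.\<close>

lemma cset_ext_choose_lit_subset:
  "cset_ext I (choose_lit L F) \<subseteq> cset_ext I F"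
proof
  fix x assume x: "x \<in> cset_ext I (choose_lit L F)"
  have "\<exists>L |\<in>| CL. x \<in> lit_ext I L" if CL: "CL |\<in>| F" for CL
  proof -
    let ?CL' = "if L |\<in>| CL then {|L|} else CL |-| {|compl_lit L|}"
    have "?CL' |\<in>| choose_lit L F" using CL unfolding choose_lit_def by blast
    then have "\<exists>M |\<in>| ?CL'. x \<in> lit_ext I M" using x unfolding cset_ext_def by blast
    then show ?thesis by (auto split: if_splits)
  qed
  then show "x \<in> cset_ext I F" using x by (auto simp: cset_ext_def)
qed

text \<open>Enlarging the clause set under an existential only strengthens the demand on its
  successor.\<close>

lemma lit_ext_add_to_ex_subset:
  "lit_ext I (add_to_ex R G L) \<subseteq> lit_ext I L"
proof (cases L)
  case (Ex Q H)
  have "cset_ext I (G |\<union>| H) \<subseteq> cset_ext I H" by (rule cset_ext_antimono) simp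
  then show ?thesis using Ex by (auto simp: lit_ext_quant simp del: lit_ext.simps(3,4))
qed auto

text \<open>In the image under \<open>choose_lit L\<close>, \<open>{|L|}\<close> is the only clause
  that can contain \<open>L\<close>: the others come from clauses without \<open>L\<close> and only
  shrink.\<close>

lemma choose_lit_fixed_imp_unit_clause:
  assumes "choose_lit L F = F" "CL |\<in>| F" "L |\<in>| CL"
  shows "CL = {|L|}"
proof -
  have "CL |\<in>| choose_lit L F" using assms by simp
  then show ?thesis using assms(3) by (auto simp: choose_lit_def split: if_splits)
qed

section \<open>Top-level literals and the invariant on parents\<close>

definition lits :: "('c, 'r) cset \<Rightarrow> ('c, 'r) lit set" where
  "lits F = {L. \<exists>CL |\<in>| F. L |\<in>| CL}"

lemma lits_choose_lit: "lits (choose_lit L F) \<subseteq> lits F"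
  by (auto simp: lits_def choose_lit_def split: if_splits)

lemma lits_fminus: "lits (F |-| G) \<subseteq> lits F"
  by (auto simp: lits_def)

lemma lits_propagate_all: "lits (propagate_all R G F) \<subseteq> add_to_ex R G ` lits F"
  by (auto simp: lits_def propagate_all_def)

text \<open>The ban on universals at parents means that A2 never acts on an index that already has
  successors. The bounds keep the roles inside the domain of the model.\<close>

definition wf_family :: "('c, 'r) family \<Rightarrow> bool" where
  "wf_family \<S> \<longleftrightarrow> (\<forall>(i, R, j) \<in> snd \<S>.
     i < length (fst \<S>) \<and> j < length (fst \<S>) \<and> (\<forall>Q G. All Q G \<notin> lits (fst \<S> ! i)))"

lemma wf_familyD:
  assumes "wf_family (S, P)" "(i, R, j) \<in> P"
  shows "i < length S" "j < length S" "All Q G \<notin> lits (S ! i)"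
  using assms by (auto simp: wf_family_def)

text \<open>A1 only deletes literals. A2 needs a universal literal, so the index it rewrites is no
  parent. The premise of A3 clears the new parent of universals, and the appended member has no
  successors yet.\<close>

lemma wf_family_step:
  assumes "step \<S> \<S>'" "wf_family \<S>"
  shows "wf_family \<S>'"
  using assms
proof (induction rule: step.induct)
  case (A1 i S CL L P)
  have "All Q G \<notin> lits (S[i := choose_lit L (S ! i)] ! k)" if "(k, R, j) \<in> P" for k R j Q G
    using wf_familyD[OF A1.prems that] lits_choose_lit[of L "S ! i"] by (cases "k = i") auto
  then show ?case using wf_familyD[OF A1.prems] unfolding wf_family_def by auto
next
  case (A2 i S CL R F1 P)
  then have "All R F1 \<in> lits (S ! i)" by (auto simp: lits_def)
  then have "k \<noteq> i" if "(k, Q, j) \<in> P" for k Q j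
    using wf_familyD(3)[OF A2.prems that] by blast
  then show ?case using wf_familyD[OF A2.prems] unfolding wf_family_def by fastforce
next
  case (A3 i S R F1 P)
  have i: "All Q G \<notin> lits (S ! i |-| {|{|Ex R F1|}|})" for Q G
    using A3.hyps(2) by (fastforce simp: lits_def)
  have "All Q G \<notin> lits ((S[i := S ! i |-| {|{|Ex R F1|}|}] @ [F1]) ! k)"
    if "(k, R', j) \<in> P" for k R' j Q G
    using wf_familyD[OF A3.prems that] i by (cases "k = i") (auto simp: nth_append)
  moreover have "All Q G \<notin> lits ((S[i := S ! i |-| {|{|Ex R F1|}|}] @ [F1]) ! i)" for Q G
    using i A3.hyps(1) by (simp add: nth_append)
  ultimately show ?case
    using wf_familyD(1,2)[OF A3.prems] A3.hyps(1) unfolding wf_family_def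
    by (auto simp: less_Suc_eq)
qed

section \<open>The model read off from the final family\<close>

definition canonical_interp :: "('c, 'r) family \<Rightarrow> (nat, 'c, 'r) interp" where
  "canonical_interp \<S> = \<lparr>Dom = {..<length (fst \<S>)},
     con = (\<lambda>A. {i. i < length (fst \<S>) \<and> {|Pos A|} |\<in>| fst \<S> ! i}),
     rol = (\<lambda>R. {(i, j). (i, R, j) \<in> snd \<S>})\<rparr>"

lemma canonical_interp_simps [simp]:
  "Dom (canonical_interp (S, P)) = {..<length S}"
  "i \<in> con (canonical_interp (S, P)) A \<longleftrightarrow> i < length S \<and> {|Pos A|} |\<in>| S ! i"
  "(i, j) \<in> rol (canonical_interp (S, P)) R \<longleftrightarrow> (i, R, j) \<in> P"
  by (auto simp: canonical_interp_def)

text \<open>Completeness leaves only literal unit clauses: A1 would still shrink a longer clause, A2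
  would remove a universal, A3 an existential. Positive units hold by construction, negative ones by
  clash-freeness.\<close>

lemma complete_clash_free_imp_ext:
  assumes complete: "complete_family (S, P)" and clash: "clash_free (S, P)" and i: "i < length S"
  shows "i \<in> cset_ext (canonical_interp (S, P)) (S ! i)"
proof -
  have no_step: "\<not> step (S, P) \<S>'" for \<S>'
    using complete unfolding complete_family_def by blast
  have cf: "{||} |\<notin>| S ! i" "{|L|} |\<in>| S ! i \<Longrightarrow> {|compl_lit L|} |\<notin>| S ! i" for L
    using clash i by (auto simp: clash_free_def)
  have unit: "\<exists>L. CL = {|L|}" if CL: "CL |\<in>| S ! i" for CL
  proof -
    obtain L where L: "L |\<in>| CL" using cf(1) CL by (metis ex_fin_conv)
    then have "choose_lit L (S ! i) = S ! i" using step.A1[OF i CL] no_step by blast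
    then show ?thesis using choose_lit_fixed_imp_unit_clause CL L by blast
  qed
  have no_all: "{|All R G|} |\<notin>| S ! i" for R G
    using step.A2[OF i, of "{|All R G|}" R G P] unit no_step by (auto simp: unit_clause_def)
  have lit: "(\<exists>A. CL = {|Pos A|}) \<or> (\<exists>A. CL = {|Neg A|}) \<or> (\<exists>Q G. CL = {|Ex Q G|})"
    if CL: "CL |\<in>| S ! i" for CL
    using unit[OF CL] no_all CL by (metis lit.exhaust)
  have no_ex: "{|Ex R G|} |\<notin>| S ! i" for R G
    using step.A3[OF i, of R G P] lit no_step by blast
  have "\<exists>L |\<in>| CL. i \<in> lit_ext (canonical_interp (S, P)) L" if CL: "CL |\<in>| S ! i" for CL
    using lit[OF CL] no_ex CL cf(2)[of "Pos _"] i by auto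
  then show ?thesis using i by (auto simp: cset_ext_def)
qed

text \<open>The second conjunct is what makes the induction go through at \<open>A2\<close>: it talks about the
  successors of \<open>i\<close> that are still to be created.\<close>

lemma canonical_interp_models_derivation:
  assumes "step\<^sup>*\<^sup>* \<S> \<T>" "wf_family \<S>" "complete_family \<T>" "clash_free \<T>"
    and "i < length (fst \<S>)"
  shows "i \<in> cset_ext (canonical_interp \<T>) (fst \<S> ! i) \<and>
    (\<forall>R G j. (\<forall>H. Ex R H \<in> lits (fst \<S> ! i) \<longrightarrow> G |\<subseteq>| H) \<longrightarrow>
       (i, R, j) \<in> snd \<T> - snd \<S> \<longrightarrow> j \<in> cset_ext (canonical_interp \<T>) G)"
  using assms
proof (induction arbitrary: i rule: converse_rtranclp_induct)
  \<comment> \<open>No successor is still to be created here, so the second conjunct is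
    vacuous.\<close>
  case base
  then show ?case using complete_clash_free_imp_ext[of "fst \<T>" "snd \<T>" i] by simp
next
  case (step \<S> \<S>')
  define I where "I = canonical_interp \<T>"
  have wf: "wf_family \<S>'" using wf_family_step step by blast
  have sat: "k \<in> cset_ext I (fst \<S>' ! k)" if "k < length (fst \<S>')" for k
    using step.IH[OF wf step.prems(2,3) that] unfolding I_def by blast
  \<comment> \<open>If \<open>G\<close> lies in every \<open>R\<close>-existential now present, it
    lies in every later one as well, since the rules never shrink the clause set under an
    existential and never create a fresh one at an existing index.\<close>
  have new: "j \<in> cset_ext I G" if "k < length (fst \<S>')"
    "\<And>H. Ex R H \<in> lits (fst \<S>' ! k) \<Longrightarrow> G |\<subseteq>| H" "(k, R, j) \<in> snd \<T> - snd \<S>'" for k R G j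
    using step.IH[OF wf step.prems(2,3) that(1)] that(2,3) unfolding I_def by blast
  have Dom: "k \<in> Dom I" if "k < length (fst \<S>')" for k
    using sat[OF that] by (simp add: cset_ext_def)
  show ?case using step.hyps(1)
  proof cases
    case (A1 n S CL L P)
    have ext: "i \<in> cset_ext I (S ! i)"
      using sat[of i] A1 step.prems(4) cset_ext_choose_lit_subset[of I L "S ! i"]
      by (cases "i = n") auto
    have i: "i < length (fst \<S>')" using A1 step.prems(4) by simp
    have lits: "lits (fst \<S>' ! i) \<subseteq> lits (S ! i)"
      using lits_choose_lit[of L "S ! i"] A1 by (cases "i = n") auto
    have "j \<in> cset_ext I G" if G: "\<And>H. Ex Q H \<in> lits (S ! i) \<Longrightarrow> G |\<subseteq>| H"
      and j: "(i, Q, j) \<in> snd \<T> - P" for Q G j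
    proof (rule new[OF i])
      show "G |\<subseteq>| H" if "Ex Q H \<in> lits (fst \<S>' ! i)" for H
        using G lits that by blast
      show "(i, Q, j) \<in> snd \<T> - snd \<S>'" using j A1 by simp
    qed
    then show ?thesis using ext A1 unfolding I_def by auto
  next
    case (A2 n S CL R F1 P)
    show ?thesis
    proof (cases "i = n")
      case False
      then show ?thesis using sat[of i] new[of i] A2 step.prems(4) unfolding I_def by auto
    next
      case True
      have n: "n < length (fst \<S>')" and S'n: "fst \<S>' ! n = propagate_all R F1 (S ! n)"
        using A2 by auto
      \<comment> \<open>The universal literal at \<open>n\<close> rules out earlier successors, so
        every edge from \<open>n\<close> in \<open>\<T>\<close> is still to come.\<close>
      have not_P: "(n, Q, j) \<notin> P" for Q j
        using wf_familyD(3)[of S P n Q j R F1] A2 step.prems(1) by (auto simp: lits_def)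
      \<comment> \<open>Each existential after propagation stems from an old one with a smaller or
        equal clause set, and for the role \<open>R\<close> it has absorbed
        \<open>F1\<close>.\<close>
      have ex: "\<exists>H'. Ex Q H' \<in> lits (S ! n) \<and> H' |\<subseteq>| H \<and> (Q = R \<longrightarrow> F1 |\<subseteq>| H)"
        if H: "Ex Q H \<in> lits (propagate_all R F1 (S ! n))" for Q H
      proof -
        obtain M where "M \<in> lits (S ! n)" "Ex Q H = add_to_ex R F1 M"
          using subsetD[OF lits_propagate_all H] by (rule imageE)
        then show ?thesis by (cases M) (auto split: if_splits)
      qed
      have "\<exists>M |\<in>| D. n \<in> lit_ext I M" if D: "D |\<in>| S ! n" for D
      proof (cases "All R F1 |\<in>| D")
        case True
        \<comment> \<open>The dropped universal holds by the induction hypothesis with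
          \<open>G\<close> taken to be \<open>F1\<close>, which every remaining
          \<open>R\<close>-existential now contains.\<close>
        have "j \<in> cset_ext I F1" if "(n, j) \<in> rol I R" for j
        proof (rule new[OF n])
          show "F1 |\<subseteq>| H" if "Ex R H \<in> lits (fst \<S>' ! n)" for H
            using ex that unfolding S'n by blast
          show "(n, R, j) \<in> snd \<T> - snd \<S>'"
            using that not_P A2 unfolding I_def by (cases \<T>) auto
        qed
        then have "n \<in> lit_ext I (All R F1)"
          using Dom[OF n] unfolding lit_ext_quant by blast
        then show ?thesis using True by blast
      next
        case False
        then have "add_to_ex R F1 |`| D |\<in>| fst \<S>' ! n"
          using D unfolding S'n propagate_all_def by auto
        then obtain M where "M |\<in>| D" "n \<in> lit_ext I (add_to_ex R F1 M)"
          using sat[OF n] by (fastforce simp: cset_ext_def)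
        then show ?thesis using subsetD[OF lit_ext_add_to_ex_subset[of I R F1 M]] by blast
      qed
      then have "n \<in> cset_ext I (S ! n)" using Dom[OF n] by (auto simp: cset_ext_def)
      moreover have "j \<in> cset_ext I G" if G: "\<And>H. Ex Q H \<in> lits (S ! n) \<Longrightarrow> G |\<subseteq>| H"
        and j: "(n, Q, j) \<in> snd \<T> - P" for Q G j
      proof (rule new[OF n])
        show "G |\<subseteq>| H" if "Ex Q H \<in> lits (fst \<S>' ! n)" for H
          using ex[of Q H] G that unfolding S'n by blast
        show "(n, Q, j) \<in> snd \<T> - snd \<S>'" using j A2 by simp
      qed
      ultimately show ?thesis using True A2 unfolding I_def by auto
    qed
  next
    case (A3 n S R F1 P)
    let ?m = "length S"
    have m: "?m \<in> cset_ext I F1" using sat[of ?m] A3 by (simp add: nth_append)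
    have i: "i < length S" "i < length (fst \<S>')" using A3 step.prems(4) by auto
    have S'i: "fst \<S>' ! i = (if i = n then S ! n |-| {|{|Ex R F1|}|} else S ! i)"
      using A3 i by (auto simp: nth_append)
    have lits: "lits (fst \<S>' ! i) \<subseteq> lits (S ! i)"
      using lits_fminus[of "S ! n" "{|{|Ex R F1|}|}"] unfolding S'i by auto
    have "\<exists>M |\<in>| D. i \<in> lit_ext I M" if D: "D |\<in>| S ! i" for D
    proof (cases "i = n \<and> D = {|Ex R F1|}")
      case True
      \<comment> \<open>Rules never delete edges, so the edge just added survives into the model and
        \<open>?m\<close> witnesses the removed existential.\<close>
      have "snd \<S>' \<subseteq> snd \<T>" using step.hyps(2)
        by (induction rule: converse_rtranclp_induct) (auto elim!: step.cases)
      then have "(n, ?m) \<in> rol I R" using A3 unfolding I_def by (cases \<T>) auto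
      then have "n \<in> lit_ext I (Ex R F1)"
        using m Dom[OF i(2)] True unfolding lit_ext_quant by blast
      then show ?thesis using True by simp
    next
      case False
      then have "D |\<in>| fst \<S>' ! i" using D unfolding S'i by auto
      then show ?thesis using sat[OF i(2)] by (auto simp: cset_ext_def)
    qed
    then have "i \<in> cset_ext I (S ! i)" using Dom[OF i(2)] by (auto simp: cset_ext_def)
    moreover have "j \<in> cset_ext I G" if G: "\<And>H. Ex Q H \<in> lits (S ! i) \<Longrightarrow> G |\<subseteq>| H"
      and j: "(i, Q, j) \<in> snd \<T> - P" for Q G j
    \<comment> \<open>Either the edge is created by this very step, and then \<open>G\<close> lies
      in \<open>F1\<close>, which \<open>?m\<close> satisfies, or it comes later and the induction
      hypothesis applies.\<close>
    proof (cases "(i, Q, j) = (n, R, ?m)")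
      case True
      then have "G |\<subseteq>| F1" using G A3 by (force simp: lits_def)
      then show ?thesis using m True cset_ext_antimono[of G F1 I] by blast
    next
      case False
      then have "(i, Q, j) \<in> snd \<T> - snd \<S>'" using j A3 by auto
      then show ?thesis using new[OF i(2)] G lits by blast
    qed
    ultimately show ?thesis using A3 unfolding I_def by auto
  qed
qed

theorem mainTheorem6:
  fixes F :: "('c, 'r) cset" and \<S> :: "('c, 'r) family"
  assumes "derivable F \<S>"
    and "complete_family \<S>"
    and "clash_free \<S>"
  shows "satisfiable F"
proof -
  have deriv: "step\<^sup>*\<^sup>* ([F], {}) \<S>" using assms(1) by (simp add: derivable_def)
  have wf0: "wf_family ([F], {})" by (simp add: wf_family_def)
  have "wf_family \<S>" using deriv
    by (induction rule: rtranclp_induct) (auto intro: wf0 wf_family_step)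
  then have sub: "rol (canonical_interp \<S>) R
      \<subseteq> Dom (canonical_interp \<S>) \<times> Dom (canonical_interp \<S>)" for R
    using wf_familyD[of "fst \<S>" "snd \<S>"] by (cases \<S>) auto
  \<comment> \<open>Rules keep indices, so index 0 stands for the initial \<open>F\<close>; it also
    makes the domain nonempty.\<close>
  have ext: "0 \<in> cset_ext (canonical_interp \<S>) F"
    using canonical_interp_models_derivation[OF deriv wf0 assms(2,3), of 0] by simp
  then have "is_interp (canonical_interp \<S>)"
    using sub unfolding is_interp_def cset_ext_def by (auto simp: canonical_interp_def)
  \<comment> \<open>The domain elements are list indices, hence naturals, as
    \<open>satisfiable\<close> demands.\<close>
  then show ?thesis using ext unfolding satisfiable_def by blast
qed

end
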